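(* Let $d \geq 1$ be an odd integer and let $n \geq d$ be an integer. Then $$\operatorname{rank}(\sigma_{d,n}) = \sum_{r=0}^{(d-1)/2} \binom{n}{r}.$$
   Context: $\sigma_{d,n} = \sum_{I \subset \{1,\dots,n\}, |I| = d} \prod_{i \in I} x_i \in \mathbb{C}[x_1,\dots,x_n]$ is the elementary symmetric polynomial of degree $d$ in $n$ variables. For a form (homogeneous polynomial) $F \in \mathbb{C}[x_1,\dots,x_n]$ of degree $d$, its (symmetric tensor) rank $\operatorname{rank}(F)$ is the least integer $s$ such that $F = \sum_{i=1}^s L_i^d$ for some linear forms $L_1,\dots,L_s \in \mathbb{C}[x_1,\dots,x_n]$. *)

theory Defs
  imports
    Complex_Main
    "HOL-Library.Poly_Mapping"
    "HOL-Library.Extended_Nat"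
begin

(* Polynomials over the complex numbers in the variables x_0, x_1, x_2, ...:
   finitely supported maps from exponent vectors to coefficients, with the ring structure
   (convolution product) of HOL-Library.Poly_Mapping.  C[x_1,...,x_n] is the subring
   generated by the constants and x_1, ..., x_n. *)
type_synonym cpoly = "(nat \<Rightarrow>\<^sub>0 nat) \<Rightarrow>\<^sub>0 complex"

definition Const :: "complex \<Rightarrow> cpoly" where
  "Const c = Poly_Mapping.single 0 c"

definition X :: "nat \<Rightarrow> cpoly" where
  "X i = Poly_Mapping.single (Poly_Mapping.single i 1) 1"

definition elem_sym :: "nat \<Rightarrow> nat \<Rightarrow> cpoly" where
  "elem_sym d n = (\<Sum>I | I \<subseteq> {1..n} \<and> card I = d. \<Prod>i\<in>I. X i)"

definition linear_form :: "nat \<Rightarrow> cpoly \<Rightarrow> bool" where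
  "linear_form n L \<longleftrightarrow> (\<exists>a :: nat \<Rightarrow> complex. L = (\<Sum>i=1..n. Const (a i) * X i))"

(* The rank of F as a form of degree d in x_1, ..., x_n.  The infimum is taken in enat,
   so it is the minimum of the set if some decomposition exists and infinity otherwise;
   a finite value thus entails that a decomposition of that length exists. *)
definition sym_rank :: "nat \<Rightarrow> nat \<Rightarrow> cpoly \<Rightarrow> enat" where
  "sym_rank n d F =
     Inf (enat ` {s. \<exists>L :: nat \<Rightarrow> cpoly.
                       (\<forall>i\<in>{1..s}. linear_form n (L i)) \<and> F = (\<Sum>i=1..s. L i ^ d)})"

end

theory Submission
  imports Defs "HOL-Library.FuncSet"
begin

text \<open>
  Write \<open>d = 2k + 1\<close>. A decomposition of the elementary symmetric polynomial into \<open>d\<close>-th powers of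
  linear forms is a family of coefficient vectors, and comparing coefficients turns it into moment
  conditions: summed over the family, every monomial of degree \<open>d\<close> gives \<open>1 / d!\<close> if it is square-free
  and \<open>0\<close> otherwise (\<open>elem_sym_power_sum_iff\<close>).

  For the upper bound take one sign vector for each set \<open>I\<close> of at most \<open>k\<close> coordinates, with minus
  signs exactly on \<open>I\<close>. A monomial evaluated there depends only on its set of odd exponents, whose
  size is an odd number \<open>s \<le> d\<close>, equal to \<open>d\<close> exactly for the square-free monomials. The polynomial in \<open>s\<close>
  of degree \<open>k\<close> with zeros \<open>1, 3, \<dots>, 2k - 1\<close> separates the two cases, and a polynomial of degree \<open>k\<close>
  in \<open>s\<close> is a combination of the characters belonging to sets of size at most \<open>k\<close>
  (\<open>short_character_sum_prod_affine\<close>). Its coefficients are the weights that the powers need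
  (\<open>elem_sym_decomposition\<close>).

  For the lower bound, dehomogenise by the first coordinate. This gives weighted points in affine
  space of dimension \<open>n - 1\<close> whose weighted moments in degree at most \<open>2k\<close> are, up to the factor \<open>1 / d!\<close>,
  the coefficients of the elementary symmetric polynomial of degree \<open>2k\<close> in the remaining variables,
  so all moments of lower degree vanish. The catalecticant of that polynomial between square-free
  monomials of degrees \<open>e\<close> and \<open>2k - e\<close> is a disjointness matrix. It has full rank
  \<open>(n - 1) choose min e (2k - e)\<close>, with explicit dual forms (\<open>dual_coeff_pairing\<close>). Functions of
  different degrees fit together to a block triangular Gram matrix, so the number of points is at
  least the sum of these ranks over \<open>e = 0, \<dots>, 2k\<close>
  (\<open>card_le_of_triangular_pairing\<close>, \<open>elem_sym_decomposition_length_ge\<close>). By Pascal's rule this sum is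
  \<open>\<Sum>r\<le>k. n choose r\<close>; in the formal argument the rule appears as the indexing of the functions by
  subsets of \<open>{1..n}\<close> that may or may not contain \<open>1\<close>. This is the dimension count that apolarity
  theory performs for the ideal of the points.
\<close>

section \<open>Power sum decompositions as moment conditions\<close>

abbreviation lookup where "lookup \<equiv> Poly_Mapping.lookup"
abbreviation keys where "keys \<equiv> Poly_Mapping.keys"

text \<open>
  Multiplying by a monomial shifts the coefficients, and an exponent that is not divisible by the
  monomial gets the coefficient \<open>0\<close>. The two cases are separate lemmas, so that no exponent is ever
  subtracted from a smaller one.
\<close>

lemma lookup_single_mult_shift:
  fixes f :: "('a::cancel_comm_monoid_add) \<Rightarrow>\<^sub>0 ('b::comm_semiring_1)"
  shows "lookup (Poly_Mapping.single k c * f) (k + m) = c * lookup f m"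
  by (simp add: lookup_mult lookup_single when_mult)

lemma lookup_X_mult_eq_0:
  assumes "lookup m i = 0"
  shows "lookup (Poly_Mapping.single (Poly_Mapping.single i (1::nat)) c * f) m = (0::complex)"
proof -
  have "m \<noteq> Poly_Mapping.single i 1 + q" for q
    using assms by (auto simp: lookup_add)
  then show ?thesis
    by (simp add: lookup_mult lookup_single when_mult)
qed

lemma Const_mult_X: "Const c * X i = Poly_Mapping.single (Poly_Mapping.single i 1) c"
  by (simp add: Const_def X_def mult_single)

lemma exponent_split:
  assumes "lookup (m :: nat \<Rightarrow>\<^sub>0 nat) i \<noteq> 0"
  obtains m' where "m = Poly_Mapping.single i 1 + m'"
proof
  show "m = Poly_Mapping.single i 1 + (m - Poly_Mapping.single i 1)"
    using assms by (intro poly_mapping_eqI) (auto simp: lookup_add lookup_minus lookup_single when_def)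
qed

text \<open>
  The multinomial theorem, read off one coefficient at a time and with the factorials cleared.
  It is proved by induction on \<open>d\<close>: the coefficient of \<open>m\<close> in \<open>L * L ^ d\<close> collects the coefficients
  of \<open>m - e\<^sub>i\<close> in \<open>L ^ d\<close>. Multiplying by \<open>\<Prod> m\<^sub>i!\<close> turns the \<open>i\<close>-th contribution into \<open>m\<^sub>i\<close> times one
  and the same quantity, and the \<open>m\<^sub>i\<close> add up to \<open>d + 1\<close>.
\<close>

lemma lookup_linear_power:
  fixes a :: "nat \<Rightarrow> complex" and V :: "nat set"
  assumes V: "finite V"
  shows "(\<Prod>i\<in>V. fact (lookup m i)) * lookup ((\<Sum>i\<in>V. Const (a i) * X i) ^ d) m =
    (if keys m \<subseteq> V \<and> (\<Sum>i\<in>V. lookup m i) = d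
     then fact d * (\<Prod>i\<in>V. a i ^ lookup m i) else 0)"
proof (induction d arbitrary: m)
  case 0
  show ?case
  proof (cases "m = 0")
    case False
    then obtain i where i: "lookup m i \<noteq> 0" by (metis poly_mapping_eqI lookup_zero)
    have "(\<Sum>i\<in>V. lookup m i) \<noteq> 0" if "keys m \<subseteq> V"
    proof -
      have "i \<in> V" using that i by (auto simp: in_keys_iff)
      then show ?thesis using i V by auto
    qed
    then show ?thesis using False by (auto simp: lookup_one)
  qed simp
next
  case (Suc d)
  define L where "L = (\<Sum>i\<in>V. Const (a i) * X i)"
  define M :: "(nat \<Rightarrow>\<^sub>0 nat) \<Rightarrow> complex" where "M m = (\<Prod>i\<in>V. fact (lookup m i))" for m
  define A where "A m = (\<Prod>i\<in>V. a i ^ lookup m i)" for m :: "nat \<Rightarrow>\<^sub>0 nat"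
  define P where "P d m \<longleftrightarrow> keys m \<subseteq> V \<and> (\<Sum>i\<in>V. lookup m i) = d" for d and m :: "nat \<Rightarrow>\<^sub>0 nat"
  have IH: "M m * lookup (L ^ d) m = (if P d m then fact d * A m else 0)" for m
    unfolding M_def L_def P_def A_def by (rule Suc.IH)
  have term_eq: "M m * lookup (Const (a i) * X i * L ^ d) m =
      (if P (Suc d) m then of_nat (lookup m i) * (fact d * A m) else 0)" if i: "i \<in> V" for i
  proof (cases "lookup m i = 0")
    case True
    then show ?thesis by (simp only: Const_mult_X lookup_X_mult_eq_0) simp
  next
    case False
    then obtain m' where m: "m = Poly_Mapping.single i 1 + m'" by (rule exponent_split)
    have lm: "lookup m i = Suc (lookup m' i)" by (simp add: m lookup_add)
    have lm': "lookup m j = lookup m' j" if "j \<noteq> i" for j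
      using that by (simp add: m lookup_add lookup_single)
    have "M m = fact (lookup m i) * (\<Prod>j\<in>V-{i}. fact (lookup m' j))"
      unfolding M_def using V i by (simp add: prod.remove lm')
    moreover have "M m' = fact (lookup m' i) * (\<Prod>j\<in>V-{i}. fact (lookup m' j))"
      unfolding M_def using V i by (simp add: prod.remove)
    ultimately have M: "M m = of_nat (lookup m i) * M m'" by (simp add: lm)
    have "A m = a i ^ (lookup m i) * (\<Prod>j\<in>V-{i}. a j ^ (lookup m' j))"
      unfolding A_def using V i by (simp add: prod.remove lm')
    moreover have "A m' = a i ^ (lookup m' i) * (\<Prod>j\<in>V-{i}. a j ^ (lookup m' j))"
      unfolding A_def using V i by (simp add: prod.remove)
    ultimately have A: "A m = a i * A m'" by (simp add: lm)
    have "(\<Sum>j\<in>V. lookup m j) = lookup m i + (\<Sum>j\<in>V-{i}. lookup m' j)"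
      using V i by (simp add: sum.remove lm')
    moreover have "(\<Sum>j\<in>V. lookup m' j) = lookup m' i + (\<Sum>j\<in>V-{i}. lookup m' j)"
      using V i by (simp add: sum.remove)
    ultimately have "(\<Sum>j\<in>V. lookup m j) = Suc (\<Sum>j\<in>V. lookup m' j)" by (simp add: lm)
    moreover have "keys m \<subseteq> V \<longleftrightarrow> keys m' \<subseteq> V"
      using i lm lm' unfolding subset_iff in_keys_iff by metis
    ultimately have P: "P (Suc d) m \<longleftrightarrow> P d m'" by (simp add: P_def)
    have "lookup (Const (a i) * X i * L ^ d) m = a i * lookup (L ^ d) m'"
      unfolding m Const_mult_X by (rule lookup_single_mult_shift)
    then have "M m * lookup (Const (a i) * X i * L ^ d) m =
        of_nat (lookup m i) * a i * (M m' * lookup (L ^ d) m')"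
      by (simp add: M)
    then show ?thesis unfolding IH P A by simp
  qed
  have "M m * lookup (L ^ Suc d) m = (\<Sum>i\<in>V. M m * lookup (Const (a i) * X i * L ^ d) m)"
    by (simp add: L_def sum_distrib_right lookup_sum sum_distrib_left)
  also have "\<dots> = (if P (Suc d) m then of_nat (\<Sum>i\<in>V. lookup m i) * (fact d * A m) else 0)"
    by (simp add: term_eq sum_distrib_right)
  also have "\<dots> = (if P (Suc d) m then fact (Suc d) * A m else 0)"
    by (simp add: P_def)
  finally show ?case unfolding M_def L_def P_def A_def .
qed

lemma prod_X: "finite I \<Longrightarrow> (\<Prod>i\<in>I. X i) = Poly_Mapping.single (\<Sum>i\<in>I. Poly_Mapping.single i 1) 1"
  by (induction I rule: finite_induct) (simp_all add: X_def mult_single)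

lemma lookup_sum_single:
  fixes g :: "nat \<Rightarrow> nat"
  assumes "finite I"
  shows "lookup (\<Sum>i\<in>I. Poly_Mapping.single i (g i)) j = (if j \<in> I then g j else 0)"
  using assms by (simp add: lookup_sum lookup_single when_def)

lemma lookup_elem_sym:
  "lookup (elem_sym d n) m =
    (if keys m \<subseteq> {1..n} \<and> card (keys m) = d \<and> (\<forall>i. lookup m i \<le> 1) then 1 else 0)"
proof -
  have eq: "(\<Sum>i\<in>I. Poly_Mapping.single i 1) = m \<longleftrightarrow> I = keys m \<and> (\<forall>i. lookup m i \<le> 1)"
    if "finite I" for I
  proof
    assume "(\<Sum>i\<in>I. Poly_Mapping.single i 1) = m"
    then have "lookup m i = (if i \<in> I then 1 else 0)" for i
      using lookup_sum_single[OF that, of "\<lambda>_. 1"] by auto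
    then show "I = keys m \<and> (\<forall>i. lookup m i \<le> 1)"
      by (auto simp: in_keys_iff split: if_splits)
  next
    assume I: "I = keys m \<and> (\<forall>i. lookup m i \<le> 1)"
    have "lookup m j = (if j \<in> I then 1 else 0)" for j
      using I by (cases "lookup m j = 0") (auto simp: in_keys_iff intro: le_antisym)
    then show "(\<Sum>i\<in>I. Poly_Mapping.single i 1) = m"
      using lookup_sum_single[OF that, of "\<lambda>_. 1"] by (intro poly_mapping_eqI) auto
  qed
  have fin: "finite I" if "I \<subseteq> {1..n}" for I using that finite_subset by blast
  have "lookup (elem_sym d n) m = (\<Sum>I | I \<subseteq> {1..n} \<and> card I = d.
      if I = keys m \<and> (\<forall>i. lookup m i \<le> 1) then 1 else 0)"
    unfolding elem_sym_def lookup_sum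
    by (intro sum.cong refl) (simp add: prod_X[OF fin] lookup_single when_def eq[OF fin, unfolded One_nat_def])
  also have "\<dots> = (if keys m \<subseteq> {1..n} \<and> card (keys m) = d \<and> (\<forall>i. lookup m i \<le> 1) then 1 else 0)"
  proof (cases "\<forall>i. lookup m i \<le> 1")
    case False
    then show ?thesis by (simp only: simp_thms if_False sum.neutral_const)
  qed simp
  finally show ?thesis .
qed

text \<open>
  Everything below rests on this translation of power sum decompositions into moment conditions.
  The coefficient of \<open>x\<^sup>m\<close> in \<open>(\<Sum> a\<^sub>i x\<^sub>i) ^ d\<close> is \<open>a\<^sup>m\<close> times a multinomial coefficient depending on \<open>m\<close>
  alone. Hence the points \<open>a j\<close> decompose the elementary symmetric polynomial if and only if the
  sum over the points of a monomial of degree \<open>d\<close> vanishes unless the monomial is square-free, in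
  which case it is \<open>1 / d!\<close>.
\<close>

lemma elem_sym_power_sum_iff:
  fixes a :: "'j \<Rightarrow> nat \<Rightarrow> complex"
  shows "elem_sym d n = (\<Sum>j\<in>J. (\<Sum>i=1..n. Const (a j i) * X i) ^ d) \<longleftrightarrow>
    (\<forall>m :: nat \<Rightarrow> nat. (\<Sum>i=1..n. m i) = d \<longrightarrow>
       (\<Sum>j\<in>J. \<Prod>i=1..n. a j i ^ m i) = (if \<forall>i\<in>{1..n}. m i \<le> 1 then 1 / fact d else 0))"
    (is "?L = ?R \<longleftrightarrow> (\<forall>m. ?deg m \<longrightarrow> ?mom m)")
proof -
  have coeff: "(\<Prod>i=1..n. fact (lookup m i)) * lookup ?R m =
     (if keys m \<subseteq> {1..n} \<and> (\<Sum>i=1..n. lookup m i) = d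
      then fact d * (\<Sum>j\<in>J. \<Prod>i=1..n. a j i ^ lookup m i) else 0)" for m
    by (cases "keys m \<subseteq> {1..n} \<and> (\<Sum>i=1..n. lookup m i) = d")
      (simp_all only: lookup_sum sum_distrib_left lookup_linear_power finite_atLeastAtMost if_True if_False
        simp_thms sum.neutral_const)
  have nz: "(\<Prod>i=1..n. fact (lookup m i)) \<noteq> (0::complex)" for m :: "nat \<Rightarrow>\<^sub>0 nat"
    by simp
  have sqfree: "(\<Prod>i=1..n. fact (lookup m i)) * lookup ?L m =
     (if keys m \<subseteq> {1..n} \<and> (\<Sum>i=1..n. lookup m i) = d
      then (if \<forall>i\<in>{1..n}. lookup m i \<le> 1 then 1 else 0) else 0)" for m
  proof (cases "keys m \<subseteq> {1..n} \<and> (\<forall>i. lookup m i \<le> 1)")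
    case True
    then have "lookup m i = (if i \<in> keys m then 1 else 0)" for i
      by (cases "lookup m i = 0") (auto simp: in_keys_iff intro: le_antisym)
    then have "(\<Sum>i=1..n. lookup m i) = (\<Sum>i=1..n. if i \<in> keys m then 1 else 0)"
      by metis
    also have "\<dots> = card (keys m)"
      using True by (simp add: sum.If_cases Int_absorb1)
    finally have "(\<Sum>i=1..n. lookup m i) = card (keys m)" .
    moreover have "(\<Prod>i=1..n. fact (lookup m i)) = (1::complex)"
    proof (intro prod.neutral ballI)
      fix i
      have "lookup m i = 0 \<or> lookup m i = 1"
        using True by (metis One_nat_def le_SucE le_zero_eq)
      then show "fact (lookup m i) = (1::complex)" by auto
    qed
    ultimately show ?thesis using True by (auto simp: lookup_elem_sym)
  next
    case False
    have "lookup m i \<le> 1" if "keys m \<subseteq> {1..n}" "\<forall>i\<in>{1..n}. lookup m i \<le> 1" for i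
    proof (cases "i \<in> keys m")
      case True
      then show ?thesis using that by blast
    qed (simp add: in_keys_iff)
    with False have "\<not> (keys m \<subseteq> {1..n} \<and> (\<forall>i\<in>{1..n}. lookup m i \<le> 1))"
      by blast
    with False show ?thesis
      by (simp only: lookup_elem_sym) (simp only: if_False if_True simp_thms mult_zero_right split: if_split, blast)
  qed
  show ?thesis
  proof
    assume eq: "?L = ?R"
    show "\<forall>m. ?deg m \<longrightarrow> ?mom m"
    proof (intro allI impI)
      fix m :: "nat \<Rightarrow> nat" assume deg: "?deg m"
      define p where "p = (\<Sum>i=1..n. Poly_Mapping.single i (m i))"
      have lp: "lookup p i = (if i \<in> {1..n} then m i else 0)" for i
        unfolding p_def by (rule lookup_sum_single) simp
      have "keys p \<subseteq> {1..n}" using lp by (auto simp: in_keys_iff split: if_splits)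
      with coeff[of p] sqfree[of p] eq deg
      show "?mom m" by (auto simp: lp field_simps split: if_splits)
    qed
  next
    assume mom: "\<forall>m. ?deg m \<longrightarrow> ?mom m"
    show "?L = ?R"
    proof (rule poly_mapping_eqI)
      fix m
      have "(\<Prod>i=1..n. fact (lookup m i)) * lookup ?L m = (\<Prod>i=1..n. fact (lookup m i)) * lookup ?R m"
        unfolding coeff sqfree using mom[rule_format, of "lookup m"] by auto
      then show "lookup ?L m = lookup ?R m" using nz by simp
    qed
  qed
qed

section \<open>Decomposition by sign vectors\<close>

lemma card_subsets_le:
  assumes "finite V"
  shows "finite {I. I \<subseteq> V \<and> card I \<le> k}" "card {I. I \<subseteq> V \<and> card I \<le> k} = (\<Sum>r=0..k. card V choose r)"
proof -
  show "finite {I. I \<subseteq> V \<and> card I \<le> k}" using assms by simp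
  have "{I. I \<subseteq> V \<and> card I \<le> k} = (\<Union>r\<in>{0..k}. {I. I \<subseteq> V \<and> card I = r})" by auto
  also have "card \<dots> = (\<Sum>r=0..k. card {I. I \<subseteq> V \<and> card I = r})"
    using assms by (intro card_UN_disjoint) auto
  finally show "card {I. I \<subseteq> V \<and> card I \<le> k} = (\<Sum>r=0..k. card V choose r)"
    using assms by (simp add: n_subsets)
qed

lemma ex_root:
  fixes w :: complex
  assumes "d > 0"
  obtains c where "c ^ d = w"
proof (cases "w = 0")
  case True
  then show ?thesis using that[of 0] assms by (simp add: zero_power)
next
  case False
  have "(of_real (root d (cmod w)) * cis (Arg w / d)) ^ d = of_real (cmod w) * cis (Arg w)"
    using assms by (simp add: power_mult_distrib DeMoivre real_root_pow_pos2 flip: of_real_power)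
  also have "\<dots> = w" using rcis_cmod_Arg[of w] by (simp add: rcis_def)
  finally show ?thesis using that by blast
qed

definition signs :: "'v set \<Rightarrow> ('v \<Rightarrow> complex) \<Rightarrow> bool" where
  "signs V \<epsilon> \<longleftrightarrow> (\<forall>i\<in>V. \<epsilon> i * \<epsilon> i = 1)"

text \<open>
  On vectors of signs every polynomial is a combination of the characters \<open>\<Prod>i\<in>I. \<epsilon> i\<close>; a polynomial
  of degree at most \<open>k\<close> needs only those with \<open>card I \<le> k\<close>.
\<close>

definition short_character_sum :: "'v set \<Rightarrow> nat \<Rightarrow> (('v \<Rightarrow> complex) \<Rightarrow> complex) \<Rightarrow> bool" where
  "short_character_sum V k f \<longleftrightarrow> (\<exists>w. \<forall>\<epsilon>. signs V \<epsilon> \<longrightarrow>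
     f \<epsilon> = (\<Sum>I | I \<subseteq> V \<and> card I \<le> k. w I * (\<Prod>i\<in>I. \<epsilon> i)))"

lemma short_character_sum_cong:
  assumes "\<And>\<epsilon>. signs V \<epsilon> \<Longrightarrow> f \<epsilon> = g \<epsilon>" "short_character_sum V k f"
  shows "short_character_sum V k g"
  using assms unfolding short_character_sum_def by metis

lemma short_character_sum_character:
  assumes "finite V" "I \<subseteq> V" "card I \<le> k"
  shows "short_character_sum V k (\<lambda>\<epsilon>. \<Prod>i\<in>I. \<epsilon> i)"
  unfolding short_character_sum_def
proof (intro exI[of _ "\<lambda>K. if K = I then 1 else 0"] allI impI)
  fix \<epsilon> :: "'a \<Rightarrow> complex"
  have "(\<Sum>K | K \<subseteq> V \<and> card K \<le> k. (if K = I then 1 else 0) * (\<Prod>i\<in>K. \<epsilon> i)) =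
      (\<Sum>K | K \<subseteq> V \<and> card K \<le> k. if K = I then \<Prod>i\<in>I. \<epsilon> i else 0)"
    by (intro sum.cong) auto
  then show "(\<Prod>i\<in>I. \<epsilon> i) = (\<Sum>K | K \<subseteq> V \<and> card K \<le> k. (if K = I then 1 else 0) * (\<Prod>i\<in>K. \<epsilon> i))"
    using assms by simp
qed

lemma short_character_sum_cmult:
  assumes "short_character_sum V k f"
  shows "short_character_sum V k (\<lambda>\<epsilon>. c * f \<epsilon>)"
proof -
  from assms obtain w where w: "\<And>\<epsilon>. signs V \<epsilon> \<Longrightarrow>
      f \<epsilon> = (\<Sum>I | I \<subseteq> V \<and> card I \<le> k. w I * (\<Prod>i\<in>I. \<epsilon> i))"
    unfolding short_character_sum_def by blast
  show ?thesis unfolding short_character_sum_def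
    by (intro exI[of _ "\<lambda>I. c * w I"]) (simp add: w sum_distrib_left mult.assoc)
qed

lemma short_character_sum_add:
  assumes "short_character_sum V k f" "short_character_sum V k g"
  shows "short_character_sum V k (\<lambda>\<epsilon>. f \<epsilon> + g \<epsilon>)"
proof -
  from assms(1) obtain w where w: "\<And>\<epsilon>. signs V \<epsilon> \<Longrightarrow>
      f \<epsilon> = (\<Sum>I | I \<subseteq> V \<and> card I \<le> k. w I * (\<Prod>i\<in>I. \<epsilon> i))"
    unfolding short_character_sum_def by blast
  from assms(2) obtain v where v: "\<And>\<epsilon>. signs V \<epsilon> \<Longrightarrow>
      g \<epsilon> = (\<Sum>I | I \<subseteq> V \<and> card I \<le> k. v I * (\<Prod>i\<in>I. \<epsilon> i))"
    unfolding short_character_sum_def by blast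
  show ?thesis unfolding short_character_sum_def
    by (intro exI[of _ "\<lambda>I. w I + v I"]) (simp add: w v sum.distrib distrib_right)
qed

lemma short_character_sum_sum:
  assumes "finite S" "\<And>s. s \<in> S \<Longrightarrow> short_character_sum V k (f s)"
  shows "short_character_sum V k (\<lambda>\<epsilon>. \<Sum>s\<in>S. f s \<epsilon>)"
  using assms
proof (induction S rule: finite_induct)
  case empty
  then show ?case unfolding short_character_sum_def
    by (intro exI[of _ "\<lambda>_. 0"]) simp
next
  case (insert s S)
  then show ?case by (simp add: short_character_sum_add)
qed

text \<open>
  Because \<open>\<epsilon>\<^sub>i\<^sup>2 = 1\<close>, multiplication by \<open>\<epsilon>\<^sub>i\<close> sends the character of \<open>I\<close> to the character of the
  symmetric difference of \<open>I\<close> and \<open>{i}\<close>.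
\<close>

lemma short_character_sum_sign_mult:
  assumes V: "finite V" and I: "I \<subseteq> V" "card I \<le> k" and i: "i \<in> V"
  shows "short_character_sum V (Suc k) (\<lambda>\<epsilon>. \<epsilon> i * (\<Prod>j\<in>I. \<epsilon> j))"
proof (cases "i \<in> I")
  case True
  have fI: "finite I" using V I finite_subset by blast
  have "(\<Prod>j\<in>I - {i}. \<epsilon> j) = \<epsilon> i * (\<Prod>j\<in>I. \<epsilon> j)" if "signs V \<epsilon>" for \<epsilon> :: "'a \<Rightarrow> complex"
  proof -
    have "\<epsilon> i * \<epsilon> i = 1" using that i by (simp add: signs_def)
    then show ?thesis using True fI by (simp add: prod.remove mult.assoc[symmetric])
  qed
  moreover have "short_character_sum V (Suc k) (\<lambda>\<epsilon>. \<Prod>j\<in>I - {i}. \<epsilon> j)"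
    using V I by (intro short_character_sum_character) (auto intro: order.trans[OF card_Diff1_le])
  ultimately show ?thesis by (rule short_character_sum_cong)
next
  case False
  have fI: "finite I" using V I finite_subset by blast
  then have "(\<lambda>\<epsilon>. \<epsilon> i * (\<Prod>j\<in>I. \<epsilon> j)) = (\<lambda>\<epsilon> :: 'a \<Rightarrow> complex. \<Prod>j\<in>insert i I. \<epsilon> j)"
    using False by simp
  then show ?thesis
    using V I i fI False by (simp only:) (intro short_character_sum_character, auto)
qed

text \<open>
  Each affine factor enlarges the sets of the characters involved by at most one element.
\<close>

lemma short_character_sum_prod_affine:
  fixes c :: "nat \<Rightarrow> complex"
  assumes V: "finite V"
  shows "short_character_sum V k (\<lambda>\<epsilon>. \<Prod>j<k. (\<Sum>i\<in>V. \<epsilon> i) - c j)"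
proof (induction k)
  case 0
  show ?case using short_character_sum_character[OF V, of "{}" 0] by simp
next
  case (Suc k)
  then obtain w where w: "\<And>\<epsilon>. signs V \<epsilon> \<Longrightarrow>
      (\<Prod>j<k. (\<Sum>i\<in>V. \<epsilon> i) - c j) = (\<Sum>I | I \<subseteq> V \<and> card I \<le> k. w I * (\<Prod>i\<in>I. \<epsilon> i))"
    unfolding short_character_sum_def by blast
  let ?S = "{I. I \<subseteq> V \<and> card I \<le> k}"
  have "short_character_sum V (Suc k) (\<lambda>\<epsilon>. \<Sum>I\<in>?S. w I *
      ((\<Sum>i\<in>V. \<epsilon> i * (\<Prod>j\<in>I. \<epsilon> j)) + (- c k) * (\<Prod>j\<in>I. \<epsilon> j)))"
    using V by (intro short_character_sum_sum short_character_sum_cmult short_character_sum_add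
        short_character_sum_sign_mult short_character_sum_character) auto
  moreover have "(\<Sum>I\<in>?S. w I * ((\<Sum>i\<in>V. \<epsilon> i * (\<Prod>j\<in>I. \<epsilon> j)) + (- c k) * (\<Prod>j\<in>I. \<epsilon> j))) =
      (\<Prod>j<Suc k. (\<Sum>i\<in>V. \<epsilon> i) - c j)" if "signs V \<epsilon>" for \<epsilon>
  proof -
    have "(\<Prod>j<Suc k. (\<Sum>i\<in>V. \<epsilon> i) - c j) =
        (\<Sum>I\<in>?S. w I * (\<Prod>i\<in>I. \<epsilon> i)) * ((\<Sum>i\<in>V. \<epsilon> i) - c k)"
      by (simp add: w[OF that])
    also have "\<dots> = (\<Sum>I\<in>?S. w I * (((\<Sum>i\<in>V. \<epsilon> i) - c k) * (\<Prod>i\<in>I. \<epsilon> i)))"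
      by (simp add: sum_distrib_left mult_ac)
    also have "\<dots> = (\<Sum>I\<in>?S. w I * ((\<Sum>i\<in>V. \<epsilon> i * (\<Prod>j\<in>I. \<epsilon> j)) + (- c k) * (\<Prod>j\<in>I. \<epsilon> j)))"
      by (simp add: left_diff_distrib sum_distrib_right)
    finally show ?thesis by simp
  qed
  ultimately show ?case by (rule short_character_sum_cong[rotated])
qed

text \<open>
  The linear forms are multiples of \<open>\<Sum> \<plusminus>x\<^sub>i\<close> with at most \<open>k\<close> minus signs, placed at \<open>I\<close>. At the
  vector of these signs, the monomial with exponents \<open>m\<close> takes the value \<open>\<Prod>i\<in>I. \<epsilon> i\<close>, where
  \<open>\<epsilon> i = (-1) ^ m i\<close>. The weights are chosen so that the sum over all \<open>I\<close> depends only on the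
  number \<open>s\<close> of odd exponents. For \<open>m\<close> of odd degree \<open>d = 2k + 1\<close> this number is one of
  \<open>1, 3, \<dots>, 2k + 1\<close>, and \<open>s = d\<close> characterises the square-free monomials. Since \<open>\<Sum> \<epsilon> i = n - 2s\<close>,
  the product of the \<open>k\<close> factors \<open>\<Sum> \<epsilon> i - (n - 2(2j + 1))\<close>, \<open>j < k\<close>, vanishes exactly at the other
  values of \<open>s\<close>. Expanded in characters it gives the weights of the \<open>d\<close>-th powers, and a \<open>d\<close>-th root
  of each weight is absorbed into the linear form.
\<close>

lemma elem_sym_decomposition:
  assumes d: "d = Suc (2 * k)"
  obtains a :: "nat set \<Rightarrow> nat \<Rightarrow> complex" where
    "elem_sym d n = (\<Sum>I | I \<subseteq> {1..n} \<and> card I \<le> k. (\<Sum>i=1..n. Const (a I i) * X i) ^ d)"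
proof -
  let ?V = "{1..n}" and ?S = "{I. I \<subseteq> {1..n} \<and> card I \<le> k}"
  \<comment> \<open>The value of the sum of signs when exactly \<open>2j + 1\<close> exponents are odd; \<open>K\<close> normalises at \<open>d\<close> odd exponents.\<close>
  define c :: "nat \<Rightarrow> complex" where "c j = of_nat n - 2 * of_nat (Suc (2 * j))" for j
  define K :: complex where "K = (\<Prod>j<k. of_nat n - 2 * of_nat d - c j)"
  have K: "K \<noteq> 0"
  proof -
    have "K = (\<Prod>j<k. of_int (4 * int j - 4 * int k))"
      unfolding K_def by (intro prod.cong refl) (simp add: c_def d algebra_simps)
    moreover have "of_int (4 * int j - 4 * int k) \<noteq> (0::complex)" if "j < k" for j
      using that by (simp only: of_int_eq_0_iff)
    ultimately show ?thesis by simp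
  qed
  obtain w where w: "\<And>\<epsilon>. signs ?V \<epsilon> \<Longrightarrow>
      (\<Prod>j<k. (\<Sum>i\<in>?V. \<epsilon> i) - c j) = (\<Sum>I\<in>?S. w I * (\<Prod>i\<in>I. \<epsilon> i))"
    using short_character_sum_prod_affine[of ?V k c] unfolding short_character_sum_def by auto
  have "\<exists>r. r ^ d = w I / (K * fact d)" for I
    using ex_root[of d "w I / (K * fact d)"] d by auto
  then obtain r where r: "\<And>I. r I ^ d = w I / (K * fact d)" by metis
  define a where "a I i = r I * (if i \<in> I then -1 else 1)" for I i
  have "(\<Sum>I\<in>?S. \<Prod>i=1..n. a I i ^ m i) = (if \<forall>i\<in>?V. m i \<le> 1 then 1 / fact d else 0)"
    if deg: "(\<Sum>i=1..n. m i) = d" for m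
  proof -
    define \<epsilon> :: "nat \<Rightarrow> complex" where "\<epsilon> i = (-1) ^ m i" for i
    define oddset where "oddset = {i\<in>?V. odd (m i)}"
    have mom: "(\<Prod>i=1..n. a I i ^ m i) = w I * (\<Prod>i\<in>I. \<epsilon> i) / (K * fact d)" if "I \<subseteq> ?V" for I
    proof -
      have "a I i ^ m i = r I ^ m i * (if i \<in> I then \<epsilon> i else 1)" for i
        by (simp only: a_def \<epsilon>_def power_mult_distrib power_one if_distrib[of "\<lambda>x. x ^ m i"])
      then have "(\<Prod>i=1..n. a I i ^ m i) = r I ^ d * (\<Prod>i=1..n. if i \<in> I then \<epsilon> i else 1)"
        by (simp add: prod.distrib power_sum flip: deg)
      also have "(\<Prod>i=1..n. if i \<in> I then \<epsilon> i else 1) = (\<Prod>i\<in>I. \<epsilon> i)"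
        using that by (simp add: prod.If_cases Int_absorb1)
      finally show ?thesis by (simp add: r)
    qed
    have "signs ?V \<epsilon>" by (simp add: signs_def \<epsilon>_def flip: power_mult_distrib)
    have "(\<Sum>I\<in>?S. \<Prod>i=1..n. a I i ^ m i) = (\<Sum>I\<in>?S. w I * (\<Prod>i\<in>I. \<epsilon> i) / (K * fact d))"
      by (intro sum.cong refl mom) simp
    also have "\<dots> = (\<Prod>j<k. (\<Sum>i\<in>?V. \<epsilon> i) - c j) / (K * fact d)"
      unfolding w[OF \<open>signs ?V \<epsilon>\<close>] by (rule sum_divide_distrib[symmetric])
    also have "(\<Sum>i\<in>?V. \<epsilon> i) = of_nat n - 2 * of_nat (card oddset)"
    proof -
      have "(\<Sum>i\<in>?V. \<epsilon> i) = (\<Sum>i\<in>?V. 1 - 2 * (if odd (m i) then 1 else 0))"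
        by (intro sum.cong) (auto simp: \<epsilon>_def)
      also have "\<dots> = of_nat n - 2 * of_nat (card oddset)"
        by (simp add: sum_subtractf oddset_def flip: sum_distrib_left sum.inter_filter)
      finally show ?thesis .
    qed
    also have "(\<Prod>j<k. of_nat n - 2 * of_nat (card oddset) - c j) / (K * fact d) =
        (if \<forall>i\<in>?V. m i \<le> 1 then 1 / fact d else 0)"
    proof (cases "\<forall>i\<in>?V. m i \<le> 1")
      case True
      have "card oddset = (\<Sum>i\<in>?V. if odd (m i) then 1 else 0)"
        by (simp add: oddset_def flip: sum.inter_filter)
      also have "\<dots> = (\<Sum>i\<in>?V. m i)"
      proof (intro sum.cong refl)
        fix i assume "i \<in> ?V"
        then have "m i \<le> 1" using True by blast
        then show "(if odd (m i) then 1 else 0) = m i" by (cases "m i") auto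
      qed
      finally have "card oddset = d" using deg by simp
      then show ?thesis using True K by (simp add: K_def)
    next
      case False
      then obtain p where p: "p \<in> ?V" "m p \<ge> 2" by auto
      have "card oddset = (\<Sum>i\<in>?V. if odd (m i) then 1 else 0)"
        by (simp add: oddset_def flip: sum.inter_filter)
      also have "\<dots> < (\<Sum>i\<in>?V. m i)"
        using p by (intro sum_strict_mono_ex1 bexI[of _ p]) (auto intro: odd_pos Suc_leI)
      finally have less: "card oddset < d" using deg by simp
      have "odd (card oddset)"
      proof -
        have "even (\<Sum>i\<in>?V. m i) \<longleftrightarrow> even (card oddset)"
          unfolding oddset_def by (rule even_sum_iff) simp
        then show ?thesis using deg d by simp
      qed
      then obtain j where j: "card oddset = Suc (2 * j)" by (auto elim: oddE)
      have "j < k" using j less d by simp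
      moreover have "of_nat n - 2 * of_nat (card oddset) - c j = (0::complex)" by (simp add: c_def j)
      ultimately have "(\<Prod>j<k. of_nat n - 2 * of_nat (card oddset) - c j) = 0" by auto
      then show ?thesis using False by (simp only: if_False div_0)
    qed
    finally show ?thesis .
  qed
  then have "elem_sym d n = (\<Sum>I\<in>?S. (\<Sum>i=1..n. Const (a I i) * X i) ^ d)"
    unfolding elem_sym_power_sum_iff by blast
  then show ?thesis using that by blast
qed

section \<open>Rank of a triangular Gram matrix\<close>

text \<open>
  Elimination: an equation \<open>l\<close> with a nonzero coefficient \<open>f p l\<close> removes itself and the unknown
  \<open>p\<close> from the system.
\<close>

lemma homogeneous_system_nontrivial:
  fixes f :: "'i \<Rightarrow> 'j \<Rightarrow> 'a::field"
  assumes "finite J" "finite I" "card J < card I"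
  obtains \<alpha> where "\<exists>i\<in>I. \<alpha> i \<noteq> 0" "\<forall>j\<in>J. (\<Sum>i\<in>I. \<alpha> i * f i j) = 0"
proof -
  have "\<exists>\<alpha>. (\<exists>i\<in>I. \<alpha> i \<noteq> 0) \<and> (\<forall>j\<in>J. (\<Sum>i\<in>I. \<alpha> i * f i j) = 0)"
    using assms
  proof (induction J arbitrary: I f rule: finite_induct)
    case empty
    then show ?case by (intro exI[of _ "\<lambda>_. 1"]) (auto simp: card_gt_0_iff)
  next
    case (insert l J)
    show ?case
    proof (cases "\<forall>i\<in>I. f i l = 0")
      case True
      have "card J < card I" using insert by simp
      from insert.IH[OF insert.prems(1) this, of f] obtain \<alpha> where
        "\<exists>i\<in>I. \<alpha> i \<noteq> 0" "\<forall>j\<in>J. (\<Sum>i\<in>I. \<alpha> i * f i j) = 0" by blast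
      with True show ?thesis by (intro exI[of _ \<alpha>]) auto
    next
      case False
      then obtain p where p: "p \<in> I" "f p l \<noteq> 0" by blast
      define I' where "I' = I - {p}"
      have I': "finite I'" "card J < card I'"
        using insert p by (auto simp: I'_def)
      define g where "g i j = f i j - f i l / f p l * f p j" for i j
      from insert.IH[OF I', of g] obtain \<alpha> where
        \<alpha>: "\<exists>i\<in>I'. \<alpha> i \<noteq> 0" "\<forall>j\<in>J. (\<Sum>i\<in>I'. \<alpha> i * g i j) = 0" by blast
      define c where "c = - (\<Sum>i\<in>I'. \<alpha> i * f i l) / f p l"
      have eq: "(\<Sum>i\<in>I. (\<alpha>(p := c)) i * f i j) = (\<Sum>i\<in>I'. \<alpha> i * g i j)" for j
      proof -
        have "(\<Sum>i\<in>I. (\<alpha>(p := c)) i * f i j) = c * f p j + (\<Sum>i\<in>I'. \<alpha> i * f i j)"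
          unfolding I'_def using p insert.prems(1) by (simp add: sum.remove[of I p])
        also have "\<dots> = (\<Sum>i\<in>I'. \<alpha> i * g i j)"
          by (simp add: g_def c_def right_diff_distrib sum_subtractf sum_distrib_right sum_divide_distrib mult.assoc)
        finally show ?thesis .
      qed
      have "g i l = 0" for i using p by (simp add: g_def)
      then have "\<forall>j\<in>insert l J. (\<Sum>i\<in>I. (\<alpha>(p := c)) i * f i j) = 0"
        unfolding eq using \<alpha>(2) by auto
      moreover have "\<exists>i\<in>I. (\<alpha>(p := c)) i \<noteq> 0" using \<alpha>(1) by (auto simp: I'_def)
      ultimately show ?thesis by blast
    qed
  qed
  then show ?thesis using that by blast
qed

text \<open>
  A triangular Gram matrix with nonzero diagonal is nonsingular, and a matrix that factors through
  \<open>card J\<close> coordinates has rank at most \<open>card J\<close>. Only half of the off-diagonal entries are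
  controlled: in a vanishing combination of the \<open>p i\<close>, the term of largest \<open>deg\<close> is isolated by
  pairing with its partner.
\<close>

lemma card_le_of_triangular_pairing:
  fixes p q :: "'i \<Rightarrow> 'j \<Rightarrow> 'a::field" and deg :: "'i \<Rightarrow> nat"
  assumes fin: "finite I" "finite J"
    and diag: "\<And>i. i \<in> I \<Longrightarrow> (\<Sum>j\<in>J. p i j * q i j) \<noteq> 0"
    and tri: "\<And>i i'. i \<in> I \<Longrightarrow> i' \<in> I \<Longrightarrow> i \<noteq> i' \<Longrightarrow> deg i \<le> deg i' \<Longrightarrow> (\<Sum>j\<in>J. p i j * q i' j) = 0"
  shows "card I \<le> card J"
proof (rule ccontr)
  assume "\<not> card I \<le> card J"
  then have less: "card J < card I" by simp
  obtain \<alpha> where \<alpha>: "\<exists>i\<in>I. \<alpha> i \<noteq> 0" "\<forall>j\<in>J. (\<Sum>i\<in>I. \<alpha> i * p i j) = 0"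
    by (rule homogeneous_system_nontrivial[OF fin(2,1) less, of p])
  let ?S = "{i\<in>I. \<alpha> i \<noteq> 0}"
  have "finite (deg ` ?S)" "deg ` ?S \<noteq> {}" using fin \<alpha>(1) by auto
  then obtain t where t: "t \<in> I" "\<alpha> t \<noteq> 0" "deg t = Max (deg ` ?S)"
    using Max_in[of "deg ` ?S"] by (auto simp: image_iff)
  have max: "deg i \<le> deg t" if "i \<in> I" "\<alpha> i \<noteq> 0" for i
    using Max_ge[OF \<open>finite (deg ` ?S)\<close>, of "deg i"] that t(3) by auto
  have "0 = (\<Sum>j\<in>J. (\<Sum>i\<in>I. \<alpha> i * p i j) * q t j)" using \<alpha>(2) by simp
  also have "\<dots> = (\<Sum>i\<in>I. \<alpha> i * (\<Sum>j\<in>J. p i j * q t j))"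
    by (simp add: sum_distrib_left sum_distrib_right mult.assoc sum.swap[of _ I J])
  also have "\<dots> = (\<Sum>i\<in>I. if i = t then \<alpha> t * (\<Sum>j\<in>J. p t j * q t j) else 0)"
    using tri[OF _ t(1)] max by (intro sum.cong refl) fastforce
  also have "\<dots> = \<alpha> t * (\<Sum>j\<in>J. p t j * q t j)" using t fin by simp
  finally show False using diag[OF t(1)] t(2) by simp
qed

section \<open>Inverting the disjointness matrix\<close>

lemma sum_alternating_Pow:
  assumes "finite A"
  shows "(\<Sum>T\<in>Pow A. (-1) ^ card T) = (if A = {} then 1 else 0 :: 'a::comm_ring_1)"
  using prod_diff_conv_sum[OF assms, of "\<lambda>_. 1::'a" "\<lambda>_. 1"] assms
  by (simp add: power_0_left)

lemma card_subsets_between: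
  assumes "finite W" "T \<subseteq> W"
  shows "card {C. T \<subseteq> C \<and> C \<subseteq> W \<and> card C = card T + r} = (card W - card T) choose r"
proof -
  have fT: "finite T" using assms finite_subset by blast
  have "bij_betw (\<lambda>D. T \<union> D) {D. D \<subseteq> W - T \<and> card D = r} {C. T \<subseteq> C \<and> C \<subseteq> W \<and> card C = card T + r}"
  proof (rule bij_betwI[where g = "\<lambda>C. C - T"])
    show "(\<lambda>D. T \<union> D) \<in> {D. D \<subseteq> W - T \<and> card D = r} \<rightarrow> {C. T \<subseteq> C \<and> C \<subseteq> W \<and> card C = card T + r}"
    proof
      fix D assume "D \<in> {D. D \<subseteq> W - T \<and> card D = r}"
      then have D: "D \<subseteq> W - T" "card D = r" by auto
      then have "finite D" "T \<inter> D = {}" using assms finite_subset by blast+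
      then show "T \<union> D \<in> {C. T \<subseteq> C \<and> C \<subseteq> W \<and> card C = card T + r}"
        using D fT assms by (auto simp: card_Un_disjoint)
    qed
    show "(\<lambda>C. C - T) \<in> {C. T \<subseteq> C \<and> C \<subseteq> W \<and> card C = card T + r} \<rightarrow> {D. D \<subseteq> W - T \<and> card D = r}"
      using fT by (auto simp: card_Diff_subset)
  qed auto
  then have "card {C. T \<subseteq> C \<and> C \<subseteq> W \<and> card C = card T + r} = card {D. D \<subseteq> W - T \<and> card D = r}"
    by (rule bij_betw_same_card[symmetric])
  also have "\<dots> = (card W - card T) choose r"
    using assms fT by (simp add: n_subsets card_Diff_subset)
  finally show ?thesis .
qed

text \<open>
  For \<open>card A = card B\<close>, inclusion-exclusion writes the Kronecker delta \<open>A = B\<close> as the alternating sum,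
  over \<open>T \<subseteq> A\<close>, of the conditions \<open>T \<inter> B = {}\<close>. Such a condition is in turn the number of \<open>f\<close>-sets \<open>C\<close>
  with \<open>T \<subseteq> C\<close> and \<open>C \<inter> B = {}\<close>, divided by a binomial coefficient, in a ground set of \<open>N\<close>
  elements. Collecting the contributions to each \<open>C\<close> gives the following coefficients.
\<close>

definition dual_coeff :: "nat \<Rightarrow> nat \<Rightarrow> 'v set \<Rightarrow> 'v set \<Rightarrow> complex" where
  "dual_coeff N f A C =
    (\<Sum>T\<in>Pow (A \<inter> C). (-1) ^ card T / of_nat ((N - card A - card T) choose (f - card T)))"

text \<open>
  The disjointness matrix between the \<open>card A\<close>-subsets and the \<open>f\<close>-subsets of \<open>U\<close> has an explicit
  right inverse. The two inequalities guarantee that the binomial coefficients in \<open>dual_coeff\<close> do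
  not vanish: every \<open>T \<subseteq> A\<close> disjoint from \<open>B\<close> extends to an \<open>f\<close>-set disjoint from \<open>B\<close>.
\<close>

lemma dual_coeff_pairing:
  fixes A B U :: "'v set"
  assumes U: "finite U" and A: "A \<subseteq> U" and B: "B \<subseteq> U" and card: "card B = card A"
    and f: "card A \<le> f" "card A + f \<le> card U"
  shows "(\<Sum>C | C \<subseteq> U - B \<and> card C = f. dual_coeff (card U) f A C) = (if A = B then 1 else 0)"
proof -
  have fin: "finite A" "finite B" using U A B finite_subset by blast+
  define w :: "'v set \<Rightarrow> complex" where
    "w T = (-1) ^ card T / of_nat ((card U - card A - card T) choose (f - card T))" for T
  let ?F = "{C. C \<subseteq> U - B \<and> card C = f}"
  have finF: "finite ?F" using U by simp
  have cT: "card T \<le> card A" if "T \<subseteq> A" for T using that fin card_mono by blast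
  have count: "w T * of_nat (card {C \<in> ?F. T \<subseteq> C}) = (if T \<subseteq> A - B then (-1) ^ card T else 0)"
    if T: "T \<subseteq> A" for T
  proof (cases "T \<inter> B = {}")
    case True
    have "{C \<in> ?F. T \<subseteq> C} = {C. T \<subseteq> C \<and> C \<subseteq> U - B \<and> card C = card T + (f - card T)}"
      using cT[OF T] f by auto
    then have "card {C \<in> ?F. T \<subseteq> C} = (card (U - B) - card T) choose (f - card T)"
      using card_subsets_between[of "U - B" T "f - card T"] U T A True by auto
    also have "card (U - B) = card U - card A" using fin B card by (simp add: card_Diff_subset)
    finally have c: "card {C \<in> ?F. T \<subseteq> C} = (card U - card A - card T) choose (f - card T)" .
    have "(card U - card A - card T) choose (f - card T) > 0"
      using f by (intro zero_less_binomial) simp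
    moreover have "T \<subseteq> A - B" using True T by blast
    ultimately show ?thesis by (simp only: w_def c if_True) simp
  next
    case False
    then have "{C \<in> ?F. T \<subseteq> C} = {}" by blast
    moreover have "\<not> T \<subseteq> A - B" using False by blast
    ultimately show ?thesis by (simp only: if_False card.empty of_nat_0 mult_zero_right)
  qed
  have "(\<Sum>C\<in>?F. dual_coeff (card U) f A C) = (\<Sum>C\<in>?F. \<Sum>T\<in>Pow A. if T \<subseteq> C then w T else 0)"
  proof (intro sum.cong refl)
    fix C
    have "Pow (A \<inter> C) = {T \<in> Pow A. T \<subseteq> C}" by blast
    then show "dual_coeff (card U) f A C = (\<Sum>T\<in>Pow A. if T \<subseteq> C then w T else 0)"
      unfolding dual_coeff_def w_def using fin by (simp only: sum.inter_filter[symmetric] finite_Pow_iff)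
  qed
  also have "\<dots> = (\<Sum>T\<in>Pow A. \<Sum>C\<in>?F. if T \<subseteq> C then w T else 0)"
    by (rule sum.swap)
  also have "\<dots> = (\<Sum>T\<in>Pow A. w T * of_nat (card {C \<in> ?F. T \<subseteq> C}))"
    by (simp only: sum.inter_filter[symmetric, OF finF] sum_constant mult.commute)
  also have "\<dots> = (\<Sum>T\<in>Pow A. if T \<subseteq> A - B then (-1) ^ card T else 0)"
    by (intro sum.cong refl count) simp
  also have "\<dots> = (\<Sum>T\<in>{T \<in> Pow A. T \<subseteq> A - B}. (-1) ^ card T)"
    using fin by (simp only: sum.inter_filter finite_Pow_iff)
  also have "{T \<in> Pow A. T \<subseteq> A - B} = Pow (A - B)" by blast
  also have "(\<Sum>T\<in>Pow (A - B). (-1) ^ card T) = (if A - B = {} then 1 else 0 :: complex)"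
    using fin by (simp add: sum_alternating_Pow)
  also have "A - B = {} \<longleftrightarrow> A = B"
    using card_subset_eq[OF fin(2)] card by auto
  finally show ?thesis by simp
qed

section \<open>The lower bound\<close>

text \<open>
  The moment conditions after dehomogenising by the first coordinate: the point \<open>a j\<close> becomes the
  affine point with coordinates \<open>a j i / a j 1\<close>, of weight \<open>a j 1 ^ d\<close>. The product of the monomials of
  \<open>B\<close> and \<open>C\<close> is homogenised by the power \<open>d - card B - card C\<close> of the first variable. This power is
  positive, so the points with \<open>a j 1 = 0\<close> contribute nothing to the homogeneous moment; on the affine
  side their weight is \<open>0\<close>, whatever the quotients by \<open>0\<close> are. The result is square-free precisely if
  \<open>B\<close> and \<open>C\<close> are disjoint and that power is \<open>1\<close>.
\<close>

lemma weighted_square_free_moments: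
  fixes a :: "'j \<Rightarrow> nat \<Rightarrow> complex"
  assumes d: "d = Suc (2 * k)" and n: "n \<ge> d"
    and decomp: "elem_sym d n = (\<Sum>j\<in>J. (\<Sum>i=1..n. Const (a j i) * X i) ^ d)"
    and BC: "B \<subseteq> {2..n}" "C \<subseteq> {2..n}" "card B + card C \<le> 2 * k"
  shows "(\<Sum>j\<in>J. a j 1 ^ d * (\<Prod>i\<in>B. a j i / a j 1) * (\<Prod>i\<in>C. a j i / a j 1)) =
    (if B \<inter> C = {} \<and> card B + card C = 2 * k then 1 / fact d else 0)"
proof -
  define r where "r = d - card B - card C"
  have r: "r \<ge> 1" "d = r + card B + card C" using BC d by (auto simp: r_def)
  define m where "m i = (if i = 1 then r else (if i \<in> B then 1 else 0) + (if i \<in> C then 1 else 0))" for i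
  have V: "{1..n} = insert 1 {2..n}" using n d by auto
  have "(\<Sum>i\<in>{2..n}. m i) = (\<Sum>i\<in>{2..n}. (if i \<in> B then 1 else 0) + (if i \<in> C then 1 else 0))"
    by (intro sum.cong) (auto simp: m_def)
  also have "\<dots> = card B + card C"
    using BC by (simp add: sum.distrib sum.If_cases Int_absorb1)
  finally have "(\<Sum>i=1..n. m i) = d" unfolding V by (simp add: m_def r)
  then have mom: "(\<Sum>j\<in>J. \<Prod>i=1..n. a j i ^ m i) = (if \<forall>i\<in>{1..n}. m i \<le> 1 then 1 / fact d else 0)"
    using decomp unfolding elem_sym_power_sum_iff by blast
  have "(\<forall>i\<in>{1..n}. m i \<le> 1) \<longleftrightarrow> B \<inter> C = {} \<and> card B + card C = 2 * k"
  proof -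
    have "m 1 \<le> 1 \<longleftrightarrow> card B + card C = 2 * k" using r d by (auto simp: m_def)
    moreover have "(\<forall>i\<in>{2..n}. m i \<le> 1) \<longleftrightarrow> B \<inter> C = {}"
      using BC by (fastforce simp: m_def)
    ultimately show ?thesis unfolding V by auto
  qed
  moreover have "(\<Prod>i=1..n. a j i ^ m i) = a j 1 ^ d * (\<Prod>i\<in>B. a j i / a j 1) * (\<Prod>i\<in>C. a j i / a j 1)" for j
  proof -
    have "(\<Prod>i\<in>{2..n}. a j i ^ m i) =
        (\<Prod>i\<in>{2..n}. (if i \<in> B then a j i else 1) * (if i \<in> C then a j i else 1))"
      by (intro prod.cong) (auto simp: m_def power2_eq_square numeral_2_eq_2)
    also have "\<dots> = (\<Prod>i\<in>B. a j i) * (\<Prod>i\<in>C. a j i)"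
      using BC by (simp add: prod.distrib prod.If_cases Int_absorb1)
    finally have "(\<Prod>i=1..n. a j i ^ m i) = a j 1 ^ r * ((\<Prod>i\<in>B. a j i) * (\<Prod>i\<in>C. a j i))"
      unfolding V by (simp add: m_def)
    also have "\<dots> = a j 1 ^ d * (\<Prod>i\<in>B. a j i / a j 1) * (\<Prod>i\<in>C. a j i / a j 1)"
    proof (cases "a j 1 = 0")
      case True
      then have "a j 1 ^ r = 0" "a j 1 ^ d = 0" using r d by simp_all
      then show ?thesis by (simp only: mult_zero_left)
    next
      case False
      then show ?thesis by (simp add: r(2) prod_dividef power_add field_simps)
    qed
    finally show ?thesis .
  qed
  ultimately show ?thesis using mom by simp
qed

text \<open>
  The affine points carry a weighted functional that kills all polynomials of degree below \<open>2k\<close>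
  and is, up to a factor, the indicator of square-free monomials in degree \<open>2k\<close>. The monomials \<open>y B\<close>
  with \<open>card B \<le> k\<close> are paired with the dual forms \<open>D A\<close> of degree \<open>2k - card A\<close>. In order of
  increasing degree, the functions used are the \<open>y B\<close> with \<open>card B \<le> k\<close> and then the \<open>D A\<close> with
  \<open>card A < k\<close>; their partners are \<open>D B\<close> and \<open>y A\<close> respectively. A function and the partner of a
  function of higher degree multiply to a polynomial of degree below \<open>2k\<close>, so the pairing is triangular.
  Both families are indexed together by the subsets \<open>R\<close> of \<open>{1..n}\<close> with at most \<open>k\<close> elements: the
  element \<open>1\<close> marks a function of the second kind.
\<close>

lemma elem_sym_decomposition_length_ge:
  fixes a :: "'j \<Rightarrow> nat \<Rightarrow> complex"
  assumes d: "d = Suc (2 * k)" and n: "n \<ge> d" and J: "finite J"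
    and decomp: "elem_sym d n = (\<Sum>j\<in>J. (\<Sum>i=1..n. Const (a j i) * X i) ^ d)"
  shows "(\<Sum>r=0..k. n choose r) \<le> card J"
proof -
  let ?U = "{2..n}"
  define y where "y B j = (\<Prod>i\<in>B. a j i / a j 1)" for B j
  define D where "D A j = (\<Sum>C | C \<subseteq> ?U \<and> card C = 2 * k - card A.
      dual_coeff (card ?U) (2 * k - card A) A C * y C j)" for A j
  have mom: "(\<Sum>j\<in>J. a j 1 ^ d * y B j * y C j) =
      (if B \<inter> C = {} \<and> card B + card C = 2 * k then 1 / fact d else 0)"
    if "B \<subseteq> ?U" "C \<subseteq> ?U" "card B + card C \<le> 2 * k" for B C
    unfolding y_def using that by (rule weighted_square_free_moments[OF d n decomp])
  have dual: "(\<Sum>j\<in>J. a j 1 ^ d * y B j * D A j) = (if A = B then 1 / fact d else 0)"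
    if A: "A \<subseteq> ?U" "card A \<le> k" and B: "B \<subseteq> ?U" "card B \<le> card A" for A B
  proof -
    let ?f = "2 * k - card A"
    let ?F = "{C. C \<subseteq> ?U \<and> card C = ?f}"
    let ?c = "dual_coeff (card ?U) ?f A"
    have "(\<Sum>j\<in>J. a j 1 ^ d * y B j * D A j) = (\<Sum>j\<in>J. \<Sum>C\<in>?F. ?c C * (a j 1 ^ d * y B j * y C j))"
      by (simp add: D_def sum_distrib_left mult_ac)
    also have "\<dots> = (\<Sum>C\<in>?F. ?c C * (\<Sum>j\<in>J. a j 1 ^ d * y B j * y C j))"
      by (subst sum.swap) (simp add: sum_distrib_left)
    also have "\<dots> = (\<Sum>C\<in>?F. ?c C * (if B \<inter> C = {} \<and> card B = card A then 1 / fact d else 0))"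
    proof (intro sum.cong refl)
      fix C assume C: "C \<in> ?F"
      have "card B + card C \<le> 2 * k" "card B + card C = 2 * k \<longleftrightarrow> card B = card A"
        using A B C by auto
      then have "(\<Sum>j\<in>J. a j 1 ^ d * y B j * y C j) =
          (if B \<inter> C = {} \<and> card B = card A then 1 / fact d else 0)"
        using B C by (subst mom) simp_all
      then show "?c C * (\<Sum>j\<in>J. a j 1 ^ d * y B j * y C j) =
          ?c C * (if B \<inter> C = {} \<and> card B = card A then 1 / fact d else 0)" by (simp only:)
    qed
    also have "\<dots> = (if A = B then 1 / fact d else 0)"
    proof (cases "card B = card A")
      case True
      have "(\<Sum>C\<in>?F. ?c C * (if B \<inter> C = {} \<and> card B = card A then 1 / fact d else 0)) =
          (\<Sum>C\<in>?F. if B \<inter> C = {} then ?c C / fact d else 0)"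
        using True by (intro sum.cong refl) simp
      also have "\<dots> = (\<Sum>C\<in>{C\<in>?F. B \<inter> C = {}}. ?c C / fact d)"
        by (rule sum.inter_filter[symmetric]) simp
      also have "{C\<in>?F. B \<inter> C = {}} = {C. C \<subseteq> ?U - B \<and> card C = ?f}" by auto
      also have "(\<Sum>C\<in>\<dots>. ?c C / fact d) = (if A = B then 1 else 0) / fact d"
        unfolding sum_divide_distrib[symmetric]
        using A B True d n by (subst dual_coeff_pairing) auto
      finally show ?thesis by simp
    qed auto
    finally show ?thesis .
  qed
  define p where "p R j = (if 1 \<in> R then D (R - {1}) j else y R j)" for R j
  define q where "q R j = a j 1 ^ d * (if 1 \<in> R then y (R - {1}) j else D R j)" for R j
  \<comment> \<open>\<open>e R\<close> is the degree of \<open>p R\<close>.\<close>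
  define e where "e R = (if 1 \<in> R then 2 * k - card (R - {1}) else card R)" for R :: "nat set"
  let ?I = "{R. R \<subseteq> {1..n} \<and> card R \<le> k}"
  have R1: "R - {1} \<subseteq> ?U" "card (R - {1}) < k" if "R \<in> ?I" "1 \<in> R" for R
  proof -
    have "finite R" using that finite_subset by blast
    then show "card (R - {1}) < k" using that card_Diff1_less[of R 1] by force
    show "R - {1} \<subseteq> ?U" using that by force
  qed
  have R0: "R \<subseteq> ?U" "card R \<le> k" if "R \<in> ?I" "1 \<notin> R" for R
  proof -
    have "i \<noteq> 1" if "i \<in> R" for i using that \<open>1 \<notin> R\<close> by auto
    then show "R \<subseteq> ?U" using that by force
  qed (use that in auto)
  have pair: "(\<Sum>j\<in>J. p R j * q S j) = (if R = S then 1 / fact d else 0)"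
    if RS: "R \<in> ?I" "S \<in> ?I" "e R \<le> e S" for R S
  proof -
    consider "1 \<in> R" "1 \<in> S" | "1 \<in> R" "1 \<notin> S" | "1 \<notin> R" "1 \<in> S" | "1 \<notin> R" "1 \<notin> S" by blast
    then show ?thesis
    proof cases
      case 1
      have "(\<Sum>j\<in>J. p R j * q S j) = (\<Sum>j\<in>J. a j 1 ^ d * y (S - {1}) j * D (R - {1}) j)"
        using 1 by (simp add: p_def q_def mult_ac)
      also have "\<dots> = (if R - {1} = S - {1} then 1 / fact d else 0)"
        using R1[of R] R1[of S] RS 1 by (intro dual) (auto simp: e_def)
      also have "R - {1} = S - {1} \<longleftrightarrow> R = S" using 1 by blast
      finally show ?thesis .
    next
      case 2
      \<comment> \<open>Excluded by the degrees: \<open>e S \<le> k < e R\<close>.\<close>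
      then show ?thesis using R1[of R] R0[of S] RS by (auto simp: e_def)
    next
      case 3
      have "(\<Sum>j\<in>J. p R j * q S j) = (\<Sum>j\<in>J. a j 1 ^ d * y R j * y (S - {1}) j)"
        using 3 by (simp add: p_def q_def mult_ac)
      also have "\<dots> = 0"
        using R0[of R] R1[of S] RS 3 by (subst mom) auto
      finally show ?thesis using 3 by auto
    next
      case 4
      have "(\<Sum>j\<in>J. p R j * q S j) = (\<Sum>j\<in>J. a j 1 ^ d * y R j * D S j)"
        using 4 by (simp add: p_def q_def mult_ac)
      also have "\<dots> = (if S = R then 1 / fact d else 0)"
        using R0[of R] R0[of S] RS 4 by (intro dual) (auto simp: e_def)
      finally show ?thesis by auto
    qed
  qed
  have "card ?I \<le> card J"
    by (rule card_le_of_triangular_pairing[where p = p and q = q and deg = e])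
      (use J pair card_subsets_le(1)[of "{1..n}" k] in auto)
  then show ?thesis by (simp add: card_subsets_le)
qed

section \<open>The rank of elementary symmetric polynomials of odd degree\<close>

theorem theorem3p4:
  fixes d n :: nat
  assumes "d \<ge> 1" and "odd d" and "n \<ge> d"
  shows "sym_rank n d (elem_sym d n) = enat (\<Sum>r=0..(d - 1) div 2. n choose r)"
proof -
  define k where "k = (d - 1) div 2"
  have d: "d = Suc (2 * k)" using assms(2) by (auto simp: k_def elim: oddE)
  define N where "N = (\<Sum>r=0..k. n choose r)"
  define S where "S = {s. \<exists>L :: nat \<Rightarrow> cpoly.
    (\<forall>i\<in>{1..s}. linear_form n (L i)) \<and> elem_sym d n = (\<Sum>i=1..s. L i ^ d)}"
  have "N \<in> S"
  proof -
    let ?I = "{I. I \<subseteq> {1..n} \<and> card I \<le> k}"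
    obtain a :: "nat set \<Rightarrow> nat \<Rightarrow> complex" where
      a: "elem_sym d n = (\<Sum>I\<in>?I. (\<Sum>i=1..n. Const (a I i) * X i) ^ d)"
      using elem_sym_decomposition[OF d] by blast
    have "finite ?I" and card: "card ?I = N"
      by (simp_all add: card_subsets_le N_def)
    then obtain h where h: "bij_betw h {1..N} ?I"
      using ex_bij_betw_nat_finite_1[of ?I] by auto
    define L where "L j = (\<Sum>i=1..n. Const (a (h j) i) * X i)" for j
    have "elem_sym d n = (\<Sum>j=1..N. L j ^ d)"
      unfolding a L_def by (rule sum.reindex_bij_betw[OF h, symmetric])
    moreover have "linear_form n (L j)" for j
      unfolding linear_form_def L_def by (rule exI) (rule refl)
    ultimately show ?thesis unfolding S_def by blast
  qed
  moreover have "N \<le> s" if "s \<in> S" for s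
  proof -
    from that obtain L where L: "\<forall>j\<in>{1..s}. linear_form n (L j)"
      and sum: "elem_sym d n = (\<Sum>j=1..s. L j ^ d)" unfolding S_def by blast
    from L have "\<forall>j\<in>{1..s}. \<exists>a. L j = (\<Sum>i=1..n. Const (a i) * X i)"
      unfolding linear_form_def .
    then obtain a where a: "\<And>j. j \<in> {1..s} \<Longrightarrow> L j = (\<Sum>i=1..n. Const (a j i) * X i)"
      unfolding bchoice_iff by blast
    have "elem_sym d n = (\<Sum>j\<in>{1..s}. (\<Sum>i=1..n. Const (a j i) * X i) ^ d)"
      unfolding sum by (intro sum.cong refl) (simp only: a)
    from elem_sym_decomposition_length_ge[OF d assms(3) _ this] show "N \<le> s"
      by (simp add: N_def)
  qed
  ultimately have "Inf (enat ` S) = enat N"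
    by (intro antisym Inf_lower Inf_greatest) auto
  then show ?thesis unfolding sym_rank_def S_def N_def k_def .
qed

end
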